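(* Let $\mathbb{F}$ be a field, let $p_1,p_2,p_3,p_4$ be four split non-derogatory polynomials with degree $2$ in $\mathbb{F}[t]$, and let $V$ be an infinite-dimensional vector space over $\mathbb{F}$. Then every automorphism of $V$ is a $(p_1,p_2,p_3,p_4)$-product in $\mathrm{End}(V)$.
   Context: A polynomial $p\in\mathbb{F}[t]$ is called non-derogatory if $p(0)\neq 0$; it is split if it is a product of degree-one polynomials over $\mathbb{F}$. For non-derogatory polynomials $p_1,\dots,p_n$, an element $x$ of a (unital associative) $\mathbb{F}$-algebra $\mathcal{A}$ is called a $(p_1,\dots,p_n)$-product if $x=a_1\cdots a_n$ for some $a_1,\dots,a_n\in\mathcal{A}$ with $p_i(a_i)=0$ for all $i\in\{1,\dots,n\}$. *)

theory Defs
  imports "HOL-Computational_Algebra.Polynomial"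
begin

definition non_derogatory :: "'f::field poly \<Rightarrow> bool" where
  "non_derogatory p \<longleftrightarrow> poly p 0 \<noteq> 0"

definition split_poly :: "'f::field poly \<Rightarrow> bool" where
  "split_poly p \<longleftrightarrow> (\<exists>qs. (\<forall>q\<in>set qs. degree q = 1) \<and> p = prod_list qs)"

text \<open>
  A vector space is given, as in \<^locale>\<open>vector_space\<close>, by a scalar multiplication on a
  whole type. Its endomorphism algebra has composition as product and pointwise addition.
\<close>

definition endomorphisms :: "('f::field \<Rightarrow> 'v::ab_group_add \<Rightarrow> 'v) \<Rightarrow> ('v \<Rightarrow> 'v) set" where
  "endomorphisms scale = {f. Vector_Spaces.linear scale scale f}"

definition automorphisms :: "('f::field \<Rightarrow> 'v::ab_group_add \<Rightarrow> 'v) \<Rightarrow> ('v \<Rightarrow> 'v) set" where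
  "automorphisms scale = {f \<in> endomorphisms scale. bij f}"

definition infinite_dimensional :: "('f::field \<Rightarrow> 'v::ab_group_add \<Rightarrow> 'v) \<Rightarrow> bool" where
  "infinite_dimensional scale \<longleftrightarrow> \<not> (\<exists>B. finite_dimensional_vector_space scale B)"

text \<open>
  The value \<open>p(a)\<close> in the endomorphism algebra; \<open>a ^^ i\<close> is the \<open>i\<close>-fold composition of \<open>a\<close>,
  with \<open>a ^^ 0\<close> the identity.
\<close>

definition endo_poly ::
  "('f::field \<Rightarrow> 'v::ab_group_add \<Rightarrow> 'v) \<Rightarrow> 'f poly \<Rightarrow> ('v \<Rightarrow> 'v) \<Rightarrow> 'v \<Rightarrow> 'v" where
  "endo_poly scale p a = (\<lambda>v. \<Sum>i\<le>degree p. scale (coeff p i) ((a ^^ i) v))"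

text \<open>
  For \<open>ps = [p\<^sub>1, \<dots>, p\<^sub>n]\<close>, the \<open>(p\<^sub>1, \<dots>, p\<^sub>n)\<close>-products in the endomorphism algebra;
  \<open>foldr (\<circ>) [a\<^sub>1, \<dots>, a\<^sub>n] id\<close> is \<open>a\<^sub>1 \<circ> \<dots> \<circ> a\<^sub>n\<close>.
\<close>

definition is_poly_product ::
  "('f::field \<Rightarrow> 'v::ab_group_add \<Rightarrow> 'v) \<Rightarrow> 'f poly list \<Rightarrow> ('v \<Rightarrow> 'v) \<Rightarrow> bool" where
  "is_poly_product scale ps x \<longleftrightarrow>
     (\<exists>as. length as = length ps \<and>
           (\<forall>i<length ps. as ! i \<in> endomorphisms scale \<and> endo_poly scale (ps ! i) (as ! i) = (\<lambda>v. 0)) \<and>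
           x = foldr (\<circ>) as id)"

end

theory Submission
  imports Defs
begin

text \<open>
  Call an automorphism a shift if it permutes a basis without finite cycles.

  Every automorphism \<open>x\<close> of an infinite-dimensional space is a product \<open>u \<circ> v\<close> of two shifts. Both
  factors are built simultaneously by transfinite recursion along a well-ordered basis of minimal
  order type: at each stage \<open>u\<close> is a partial map whose domain is spanned by fewer vectors than the
  dimension, and the orbits of \<open>u\<close> and of \<open>v = u\<^sup>-\<^sup>1 x\<close> are unions of disjoint paths in independent
  sets. Sending new basis vectors of the domain of \<open>u\<close> to basis vectors that have not occurred so
  far prolongs the \<open>u\<close>-paths forwards and the \<open>v\<close>-paths backwards; the range is enlarged in the
  same way after replacing \<open>x\<close> and \<open>u\<close> by their inverses.

  A single shift orbit \<open>(e\<^sub>n)\<close> over the integers has a second basis \<open>(f\<^sub>n)\<close>, triangular with respect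
  to the first one, on which the shift is the product of two maps that are direct sums of
  companion matrices of the prescribed quadratic polynomials and of a root of the second one.
\<close>

unbundle cardinal_syntax

subsection \<open>Cardinality bounds\<close>

text \<open>Being finite when \<open>K\<close> is finite makes the bound usable for countable dimension as well.\<close>
definition small :: "'a set \<Rightarrow> 'b set \<Rightarrow> bool" where
  "small K X \<longleftrightarrow> (if finite K then finite X else |X| \<le>o |K| )"

lemma finite_imp_small: "finite X \<Longrightarrow> small K X"
  by (simp add: small_def ordLeq3_finite_infinite)

lemma small_self: "small K K"
  by (simp add: small_def card_of_refl ordIso_imp_ordLeq)

lemma small_subset: "small K X \<Longrightarrow> Y \<subseteq> X \<Longrightarrow> small K Y"
  unfolding small_def by (metis card_of_mono1 finite_subset ordLeq_transitive)

lemma small_mono: "small K X \<Longrightarrow> K \<subseteq> L \<Longrightarrow> small L X"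
  unfolding small_def
  by (metis card_of_mono1 finite_subset ordLeq3_finite_infinite ordLeq_transitive)

lemma small_image: "small K X \<Longrightarrow> small K (f ` X)"
  unfolding small_def by (metis card_of_image finite_imageI ordLeq_transitive)

lemma small_UN: "small K I \<Longrightarrow> (\<And>i. i \<in> I \<Longrightarrow> small K (A i)) \<Longrightarrow> small K (\<Union>i\<in>I. A i)"
  unfolding small_def using card_of_UNION_ordLeq_infinite[of K I A] by (auto split: if_splits)

lemma small_Un: "small K X \<Longrightarrow> small K Y \<Longrightarrow> small K (X \<union> Y)"
  using small_UN[of K "UNIV :: bool set" "\<lambda>b. if b then X else Y"]
  by (auto simp: finite_imp_small UNIV_bool Un_commute split: if_splits)

text \<open>If \<open>M\<close> did not embed, \<open>B - C\<close> would have smaller cardinality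
  than \<open>M\<close>, hence be small, and \<open>B\<close> would be covered by two small sets.
  This supplies the fresh basis vectors of the construction.\<close>

lemma inj_into_Diff_small:
  assumes B: "infinite B" and K: "|K| <o |B|" and C: "small K C" and M: "small K M"
  shows "\<exists>h. inj_on h M \<and> h ` M \<subseteq> B - C"
proof (cases "|M| \<le>o |B - C|")
  case True
  then show ?thesis by (simp add: card_of_ordLeq)
next
  case False
  then have less: "|B - C| <o |M|"
    using not_ordLeq_iff_ordLess[OF card_of_Well_order card_of_Well_order] by blast
  have "small K (B - C)"
    using M ordLess_imp_ordLeq[OF less] unfolding small_def
    by (metis card_of_ordLeq_finite ordLeq_transitive)
  then have "small K (C \<union> (B - C))" using C by (rule small_Un[rotated])
  then have "small K B" by (rule small_subset) blast
  with B have "infinite K" "|B| \<le>o |K|" by (auto simp: small_def split: if_splits)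
  then show ?thesis using K not_ordLess_ordLeq by blast
qed

subsection \<open>Independent sets\<close>

context vector_space
begin

interpretation self: vector_space_pair scale scale ..

text \<open>A dependence relation meets \<open>T\<close> in finitely many vectors, so a finite
  second set suffices, and its vectors can be added one at a time.\<close>

lemma span_disjoint_imp_independent_Un:
  assumes "independent S" "independent T" and disj: "span S \<inter> span T \<subseteq> {0}"
  shows "independent (S \<union> T)"
proof -
  have *: "independent (X \<union> Y)" if X: "independent X" and f: "finite Y" and Y: "independent Y"
     and d: "span X \<inter> span Y \<subseteq> {0}" for X Y
    using f Y d
  proof (induction Y rule: finite_induct)
    case empty then show ?case using X by simp
  next
    case (insert y Y)
    have iy: "independent (X \<union> Y)"
      using insert independent_mono[of "insert y Y" Y] span_mono[of Y "insert y Y"] by blast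
    have "y \<notin> span (X \<union> Y)"
    proof
      assume "y \<in> span (X \<union> Y)"
      then obtain a b where ab: "y = a + b" "a \<in> span X" "b \<in> span Y" unfolding span_Un by blast
      have "a = y - b" using ab by simp
      moreover have "y - b \<in> span (insert y Y)"
        using ab span_mono[of Y "insert y Y"] by (intro span_diff) (auto intro: span_base)
      ultimately have "a = 0" using ab(2) insert.prems by blast
      then have "y \<in> span Y" using ab by simp
      then show False using insert.prems(1) insert.hyps(2) unfolding dependent_def by auto
    qed
    then show ?case using iy by (simp add: independent_insertI)
  qed
  show ?thesis
    unfolding dependent_explicit
  proof (rule notI, elim exE conjE bexE)
    fix F c v assume F: "finite F" "F \<subseteq> S \<union> T" "(\<Sum>w\<in>F. c w *s w) = 0" "v \<in> F" "c v \<noteq> 0"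
    have "independent (S \<union> (F \<inter> T))"
      using assms F(1) independent_mono[of T "F \<inter> T"] span_mono[of "F \<inter> T" T] by (intro *) auto
    then show False
      using F independentD[of "S \<union> (F \<inter> T)" F c v] by blast
  qed
qed

text \<open>The \<open>B\<close>-coordinates of a common vector vanish both outside \<open>C\<close>
  and outside \<open>B - C\<close>.\<close>

lemma span_Int_span_Diff:
  assumes "independent B" "C \<subseteq> B"
  shows "span C \<inter> span (B - C) \<subseteq> {0}"
proof
  fix v assume v: "v \<in> span C \<inter> span (B - C)"
  have "representation B v = representation C v" "representation B v = representation (B - C) v"
    using v assms by (auto intro!: representation_extend)
  then have "representation B v b = 0" for b
    using representation_ne_zero[of C v b] representation_ne_zero[of "B - C" v b] by auto
  moreover have "v \<in> span B" using v span_mono[OF assms(2)] by blast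
  ultimately have "v = 0"
    using sum_nonzero_representation_eq[OF assms(1), of v] by simp
  then show "v \<in> {0}" by simp
qed

lemma small_support:
  assumes B: "span B = UNIV" and Z: "small K Z"
  shows "\<exists>C. C \<subseteq> B \<and> small K C \<and> Z \<subseteq> span C"
proof -
  have "\<exists>F. finite F \<and> F \<subseteq> B \<and> z \<in> span F" for z
  proof -
    have "z \<in> span B" using B by simp
    then obtain t r where "finite t" "t \<subseteq> B" "z = (\<Sum>a\<in>t. r a *s a)" unfolding span_explicit by blast
    then show ?thesis by (intro exI[of _ t]) (auto intro: span_sum span_scale span_base)
  qed
  then obtain F where F: "\<And>z. finite (F z) \<and> F z \<subseteq> B \<and> z \<in> span (F z)" by metis
  let ?C = "\<Union>z\<in>Z. F z"
  have "Z \<subseteq> span ?C"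
  proof
    fix z assume "z \<in> Z"
    then have "F z \<subseteq> ?C" by blast
    then show "z \<in> span ?C" using F[of z] span_mono by blast
  qed
  moreover have "small K ?C"
    by (rule small_UN[OF Z]) (simp add: F finite_imp_small)
  moreover have "?C \<subseteq> B" using F by blast
  ultimately show ?thesis by (intro exI[of _ ?C] conjI)
qed

text \<open>Freshness criterion for new path vertices. Since \<open>span M\<close> and
  \<open>span (T - M)\<close> meet trivially, the kernel condition makes \<open>g\<close> injective
  on \<open>span M\<close>, with an image meeting \<open>W\<close>, hence \<open>span T\<close>,
  only in 0. It serves both for \<open>u\<close> and for the inverse of \<open>v\<close>.\<close>

lemma independent_Un_image:
  assumes g: "Vector_Spaces.linear scale scale g" and T: "independent T" "span T \<subseteq> W"
    and M: "M \<subseteq> T"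
    and ker: "\<And>y. y \<in> span T \<Longrightarrow> g y \<in> W \<Longrightarrow> y \<in> span (T - M)"
  shows "inj_on g M" "independent (T \<union> g ` M)" "g ` M \<inter> W = {}"
proof -
  have W0: "0 \<in> W" using T(2) span_zero by blast
  have zero: "y = 0" if "y \<in> span M" "g y \<in> W" for y
  proof -
    have "y \<in> span T" using that span_mono[OF M] by blast
    then have "y \<in> span (T - M)" using ker that by blast
    then show ?thesis using span_Int_span_Diff[OF T(1) M] that by blast
  qed
  have inj: "inj_on g (span M)"
    using zero W0 by (subst self.linear_inj_on_iff_eq_0[OF g subspace_span]) metis
  then show "inj_on g M" by (rule inj_on_subset) (rule span_superset)
  have "independent (g ` M)"
    using independent_mono[OF T(1) M] inj by (rule self.linear_independent_injective_image[OF g])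
  moreover have "span T \<inter> span (g ` M) \<subseteq> {0}"
  proof
    fix w assume w: "w \<in> span T \<inter> span (g ` M)"
    then obtain y where "y \<in> span M" "w = g y" unfolding self.linear_span_image[OF g] by blast
    then show "w \<in> {0}" using zero w T(2) self.linear_0[OF g] by blast
  qed
  ultimately show "independent (T \<union> g ` M)"
    using T(1) by (intro span_disjoint_imp_independent_Un)
  show "g ` M \<inter> W = {}"
  proof (rule ccontr)
    assume "g ` M \<inter> W \<noteq> {}"
    then obtain m where m: "m \<in> M" "g m \<in> W" by blast
    then have "m = 0" using zero span_base by blast
    then show False using m M T(1) dependent_zero by blast
  qed
qed

lemma independent_subset_eq_spanning:
  assumes "independent S" "D \<subseteq> S" "span D = UNIV"
  shows "D = S"
proof (rule ccontr)
  assume "D \<noteq> S"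
  then obtain s where s: "s \<in> S" "s \<notin> D" using assms(2) by blast
  then have "D \<subseteq> S - {s}" using assms(2) by blast
  then have "s \<in> span (S - {s})" using span_mono[of D "S - {s}"] assms(3) by blast
  then show False using s assms(1) dependent_def by blast
qed

text \<open>Change of basis by a triangular matrix with nonzero diagonal \<open>\<kappa>\<close>.
  Ranks may tie: between distinct indices of equal rank the coefficient is zero. Independence comes
  from a coordinate of maximal rank, spanning from induction on the rank.\<close>

lemma triangular_family:
  fixes e f :: "'j \<Rightarrow> 'b" and \<rho> :: "'j \<Rightarrow> nat"
  assumes e: "inj_on e J" "independent (e ` J)"
    and \<kappa>: "\<And>j. j \<in> J \<Longrightarrow> \<kappa> j \<noteq> 0"
    and f: "\<And>j. j \<in> J \<Longrightarrow> f j - \<kappa> j *s e j \<in> span (e ` {k \<in> J. \<rho> k < \<rho> j})"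
  shows "inj_on f J" "independent (f ` J)" "span (f ` J) = span (e ` J)"
proof -
  let ?E = "e ` J"
  define lower where "lower j = e ` {k \<in> J. \<rho> k < \<rho> j}" for j
  have f': "f j - \<kappa> j *s e j \<in> span (lower j)" if "j \<in> J" for j
    using f[OF that] by (simp add: lower_def)
  have lowerE: "lower j \<subseteq> ?E" for j by (auto simp: lower_def)
  have e_span: "e j \<in> span ?E" if "j \<in> J" for j using that by (simp add: span_base)
  have diff_span: "f j - \<kappa> j *s e j \<in> span ?E" if "j \<in> J" for j
    using subsetD[OF span_mono[OF lowerE[of j]] f'[OF that]] .
  have f_span: "f j \<in> span ?E" if "j \<in> J" for j
    using span_add[OF span_scale[OF e_span[OF that], of "\<kappa> j"] diff_span[OF that]] by simp
  have coord: "representation ?E (f k) (e j) = (if k = j then \<kappa> j else 0)"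
    if jk: "j \<in> J" "k \<in> J" "\<rho> k \<le> \<rho> j" for j k
  proof -
    have "e j \<notin> lower k"
    proof
      assume "e j \<in> lower k"
      then obtain l where l: "l \<in> J" "\<rho> l < \<rho> k" "e j = e l" by (auto simp: lower_def)
      then show False using inj_onD[OF e(1) l(3) jk(1) l(1)] jk(3) by simp
    qed
    then have "representation (lower k) (f k - \<kappa> k *s e k) (e j) = 0"
      using representation_ne_zero by blast
    moreover have "representation ?E (f k - \<kappa> k *s e k) = representation (lower k) (f k - \<kappa> k *s e k)"
      by (rule representation_extend[OF e(2) f'[OF jk(2)] lowerE])
    ultimately have 0: "representation ?E (f k - \<kappa> k *s e k) (e j) = 0" by simp
    have "representation ?E (f k) (e j) =
        representation ?E (\<kappa> k *s e k) (e j) + representation ?E (f k - \<kappa> k *s e k) (e j)"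
      using representation_add[OF e(2) diff_span[OF jk(2)] span_scale[OF e_span[OF jk(2)], of "\<kappa> k"]]
      by (simp add: add.commute)
    also have "\<dots> = \<kappa> k * (if e j = e k then 1 else 0)"
      using jk 0 by (simp add: representation_scale[OF e(2) e_span] representation_basis[OF e(2)])
    finally show ?thesis using inj_on_eq_iff[OF e(1) jk(1,2)] by simp
  qed
  have indep: "c j = 0" if F: "finite F" "F \<subseteq> J" "(\<Sum>k\<in>F. c k *s f k) = 0" "j \<in> F" for F c j
  proof (rule ccontr)
    assume "c j \<noteq> 0"
    define G where "G = {k \<in> F. c k \<noteq> 0}"
    have "j \<in> G" using F(4) \<open>c j \<noteq> 0\<close> by (simp add: G_def)
    then have G: "finite (\<rho> ` G)" "\<rho> ` G \<noteq> {}" using F(1) by (auto simp: G_def)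
    \<comment> \<open>Among the indices with nonzero coefficient one of maximal rank is taken; at
      the coordinate \<open>e m\<close> only the summand of \<open>m\<close> contributes.\<close>
    obtain m where m: "m \<in> G" "\<rho> m = Max (\<rho> ` G)" using Max_in[OF G] by fastforce
    have max: "\<rho> k \<le> \<rho> m" if "k \<in> G" for k using that G m(2) by simp
    have mJ: "m \<in> J" "m \<in> F" using m(1) F(2) by (auto simp: G_def)
    have "0 = representation ?E (\<Sum>k\<in>F. c k *s f k) (e m)" by (simp add: F(3) representation_zero)
    also have "\<dots> = (\<Sum>k\<in>F. representation ?E (c k *s f k) (e m))"
      using F(2) f_span by (subst representation_sum[OF e(2)]) (auto intro: span_scale)
    also have "\<dots> = (\<Sum>k\<in>F. if k = m then c m * \<kappa> m else 0)"
    proof (rule sum.cong[OF refl])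
      fix k assume k: "k \<in> F"
      then have kJ: "k \<in> J" using F(2) by blast
      show "representation ?E (c k *s f k) (e m) = (if k = m then c m * \<kappa> m else 0)"
      proof (cases "c k = 0")
        case True then show ?thesis using m(1) by (auto simp: G_def representation_zero)
      next
        case False
        then have "\<rho> k \<le> \<rho> m" using max k by (simp add: G_def)
        then show ?thesis
          using coord[OF mJ(1) kJ] by (simp add: representation_scale[OF e(2) f_span[OF kJ]])
      qed
    qed
    also have "\<dots> = c m * \<kappa> m" using F(1) mJ(2) by simp
    finally show False using m(1) \<kappa>[OF mJ(1)] by (simp add: G_def)
  qed
  show inj: "inj_on f J"
  proof (rule inj_onI, rule ccontr)
    fix j k assume jk: "j \<in> J" "k \<in> J" "f j = f k" "j \<noteq> k"
    then have "(\<Sum>i\<in>{j, k}. (if i = j then 1 else - 1) *s f i) = 0" by simp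
    from indep[OF _ _ this, of j] jk show False by simp
  qed
  show "independent (f ` J)"
    unfolding dependent_explicit
  proof (rule notI, elim exE conjE bexE)
    fix T c v assume T: "finite T" "T \<subseteq> f ` J" "(\<Sum>v\<in>T. c v *s v) = 0" "v \<in> T" "c v \<noteq> 0"
    obtain F where F: "F \<subseteq> J" "T = f ` F" using T(2) by (auto simp: subset_image_iff)
    have injF: "inj_on f F" using inj F(1) by (rule inj_on_subset)
    then have finF: "finite F" using T(1) F(2) by (simp add: finite_image_iff)
    obtain j where j: "j \<in> F" "v = f j" using T(4) F(2) by blast
    have "(\<Sum>k\<in>F. c (f k) *s f k) = 0" using T(3) injF by (simp add: F(2) sum.reindex)
    from indep[OF finF F(1) this j(1)] show False using T(5) j(2) by simp
  qed
  have "e j \<in> span (f ` J)" if "j \<in> J" for j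
    using that
  proof (induction "\<rho> j" arbitrary: j rule: less_induct)
    case less
    have "lower j \<subseteq> span (f ` J)" using less by (auto simp: lower_def)
    then have "span (lower j) \<subseteq> span (f ` J)" by (simp add: span_minimal)
    then have d: "f j - \<kappa> j *s e j \<in> span (f ` J)" using f'[OF less.prems] by blast
    have "f j - (f j - \<kappa> j *s e j) \<in> span (f ` J)"
      by (rule span_diff[OF span_base d]) (use less.prems in simp)
    from span_scale[OF this, of "inverse (\<kappa> j)"]
    show ?case using \<kappa>[OF less.prems] by simp
  qed
  then have "?E \<subseteq> span (f ` J)" by blast
  moreover have "f ` J \<subseteq> span ?E" using f_span by blast
  ultimately show "span (f ` J) = span ?E" unfolding span_eq by simp
qed

end

subsection \<open>Integer powers of a bijection\<close>

definition zpow :: "('a \<Rightarrow> 'a) \<Rightarrow> int \<Rightarrow> 'a \<Rightarrow> 'a" where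
  "zpow u n = (if 0 \<le> n then u ^^ nat n else inv u ^^ nat (- n))"

context
  fixes u :: "'a \<Rightarrow> 'a" assumes bij_u: "bij u"
begin

lemma zpow_0 [simp]: "zpow u 0 v = v"
  by (simp add: zpow_def)

lemma zpow_Suc: "zpow u (n + 1) v = u (zpow u n v)"
proof (cases "0 \<le> n")
  case True
  then have "nat (n + 1) = Suc (nat n)" by simp
  then show ?thesis using True by (simp add: zpow_def)
next
  case False
  then have "nat (- n) = Suc (nat (- (n + 1)))" by simp
  then show ?thesis using False bij_u by (auto simp: zpow_def surj_f_inv_f bij_is_surj)
qed

lemma zpow_pred: "zpow u (n - 1) v = inv u (zpow u n v)"
  using zpow_Suc[of "n - 1" v] bij_u by (simp add: bij_is_inj)

lemma zpow_add: "zpow u (m + n) v = zpow u m (zpow u n v)"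
proof (induction m rule: int_induct[where k = 0])
  case (step1 i)
  have "zpow u (i + 1 + n) v = zpow u ((i + n) + 1) v" by (simp add: algebra_simps)
  then show ?case using step1 by (simp only: zpow_Suc)
next
  case (step2 i)
  have "zpow u (i - 1 + n) v = zpow u ((i + n) - 1) v" by (simp add: algebra_simps)
  then show ?case using step2 by (simp only: zpow_pred)
qed simp

lemma zpow_minus: "zpow u (- n) (zpow u n v) = v"
  using zpow_add[of "- n" n v] by simp

text \<open>Freeness makes every orbit a copy of the integers, so one chosen point per orbit indexes
  \<open>S\<close> by pairs of a representative and an integer.\<close>

lemma orbit_representatives:
  assumes S: "u ` S = S" and free: "\<And>s n. s \<in> S \<Longrightarrow> 0 < n \<Longrightarrow> (u ^^ n) s \<noteq> s"
  shows "\<exists>X. inj_on (\<lambda>(i, n). zpow u n i) (X \<times> UNIV) \<and> (\<lambda>(i, n). zpow u n i) ` (X \<times> UNIV) = S"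
proof -
  have uS: "u s \<in> S" if "s \<in> S" for s using S that by blast
  have iS: "inv u s \<in> S" if "s \<in> S" for s
  proof -
    obtain t where "t \<in> S" "s = u t" using S \<open>s \<in> S\<close> by blast
    then show ?thesis using bij_u by (simp add: bij_is_inj)
  qed
  have zS: "zpow u n s \<in> S" if "s \<in> S" for n s
  proof (induction n rule: int_induct[where k = 0])
    case (step1 i) then show ?case by (simp add: zpow_Suc uS)
  next
    case (step2 i) then show ?case by (simp add: zpow_pred iS)
  qed (use that in simp)
  have free_pos: "zpow u n s \<noteq> s" if "s \<in> S" "0 < n" for n s
    using free[of s "nat n"] that by (simp add: zpow_def)
  have free_z: "n = 0" if "s \<in> S" "zpow u n s = s" for n s
    using free_pos[OF that(1), of n] free_pos[OF that(1), of "- n"] that(2) zpow_minus[of n s]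
    by (cases n "0 :: int" rule: linorder_cases) auto
  define orb where "orb s = range (\<lambda>n. zpow u n s)" for s
  \<comment> \<open>The choice depends on \<open>s\<close> only through the set
    \<open>orb s\<close>, so \<open>rep\<close> is constant along each orbit.\<close>
  define rep where "rep s = (SOME t. t \<in> orb s)" for s
  have rep: "rep s \<in> orb s" for s
    unfolding rep_def orb_def by (rule someI_ex) blast
  have orb_zpow: "orb (zpow u n s) = orb s" for n s
  proof -
    have "zpow u m (zpow u n s) \<in> orb s" for m unfolding zpow_add[symmetric] by (simp add: orb_def)
    moreover have "zpow u m s \<in> orb (zpow u n s)" for m
      unfolding orb_def using zpow_add[of "m - n" n s] by (intro range_eqI[of _ _ "m - n"]) simp
    ultimately show ?thesis unfolding orb_def by blast
  qed
  have rep_eq: "rep (zpow u n s) = rep s" for n s by (simp add: rep_def orb_zpow)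
  have rep_z: "\<exists>n. rep s = zpow u n s" for s using rep[of s] by (auto simp: orb_def)
  let ?X = "rep ` S"
  have XS: "i \<in> S" "rep i = i" if "i \<in> ?X" for i
  proof -
    obtain s where s: "s \<in> S" "i = rep s" using \<open>i \<in> ?X\<close> by blast
    obtain n where n: "rep s = zpow u n s" using rep_z by blast
    show "i \<in> S" using s n zS by simp
    show "rep i = i" using s n rep_eq[of n s] by simp
  qed
  have "inj_on (\<lambda>(i, n). zpow u n i) (?X \<times> UNIV)"
  proof (rule inj_onI, clarify)
    fix s t n m assume st: "s \<in> S" "t \<in> S" and eq: "zpow u n (rep s) = zpow u m (rep t)"
    have "rep s \<in> ?X" "rep t \<in> ?X" using st by auto
    note X = XS[OF this(1)] XS[OF this(2)]
    have same: "rep s = rep t" using arg_cong[OF eq, of rep] X by (simp add: rep_eq)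
    have "zpow u (- m + n) (rep s) = rep s"
      unfolding zpow_add eq unfolding same by (rule zpow_minus)
    then have "- m + n = 0" by (rule free_z[OF X(1)])
    then have "n = m" by simp
    then show "rep s = rep t \<and> n = m" using same by simp
  qed
  moreover have "(\<lambda>(i, n). zpow u n i) ` (?X \<times> UNIV) = S"
  proof (intro equalityI subsetI)
    fix t assume "t \<in> (\<lambda>(i, n). zpow u n i) ` (?X \<times> UNIV)"
    then show "t \<in> S" using XS(1) zS by auto
  next
    fix s assume s: "s \<in> S"
    obtain n where "rep s = zpow u n s" using rep_z by blast
    then have "s = zpow u (- n) (rep s)" by (simp add: zpow_minus)
    then show "s \<in> (\<lambda>(i, n). zpow u n i) ` (?X \<times> UNIV)"
      using s by (intro image_eqI[of _ _ "(rep s, - n)"]) auto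
  qed
  ultimately show ?thesis by blast
qed


end

subsection \<open>Partial factorizations\<close>

text \<open>No edge leaves \<open>N\<close>, so a walk that takes an edge of \<open>H\<close> ends
  there. A cycle would therefore consist of edges of \<open>R\<close> only.\<close>

lemma acyclic_Un_fresh_targets:
  assumes R: "acyclic R" and N: "Range H \<subseteq> N" "N \<inter> (Domain R \<union> Domain H) = {}"
  shows "acyclic (R \<union> H)"
proof -
  have *: "(a, b) \<in> R\<^sup>+ \<or> b \<in> N" if "(a, b) \<in> (R \<union> H)\<^sup>+" for a b
    using that
  proof (induction rule: trancl_induct)
    case (base b)
    then show ?case using N(1) by blast
  next
    case (step b c)
    from step.hyps(2) show ?case
    proof
      assume bc: "(b, c) \<in> R"
      then have "b \<notin> N" using N by blast
      then show ?thesis using step.IH bc trancl_into_trancl[of a b R c] by blast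
    qed (use N in blast)
  qed
  have "(a, a) \<notin> (R \<union> H)\<^sup>+" for a
  proof
    assume a: "(a, a) \<in> (R \<union> H)\<^sup>+"
    then have "a \<in> Domain (R \<union> H)" using trancl_domain[of "R \<union> H"] by blast
    then have "a \<notin> N" using N by auto
    then show False using *[OF a] R by (auto simp: acyclic_def)
  qed
  then show ?thesis by (simp add: acyclic_def)
qed

text \<open>A finite walk uses finitely many members of the chain, and the largest of them contains
  all its edges.\<close>

lemma chain_Un_trancl:
  assumes "\<And>R S. R \<in> C \<Longrightarrow> S \<in> C \<Longrightarrow> R \<subseteq> S \<or> S \<subseteq> R" and "(a, b) \<in> (\<Union>C)\<^sup>+"
  shows "\<exists>R\<in>C. (a, b) \<in> R\<^sup>+"
  using assms(2)
proof (induction rule: trancl_induct)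
  case (base b)
  then show ?case by blast
next
  case (step b c)
  then obtain R S where RS: "R \<in> C" "S \<in> C" "(a, b) \<in> R\<^sup>+" "(b, c) \<in> S" by blast
  have "(a, c) \<in> (R \<union> S)\<^sup>+"
    using RS trancl_mono[of "(a, b)" R "R \<union> S"] trancl_into_trancl[of a b "R \<union> S" c] by blast
  moreover have "R \<union> S \<in> C" using assms(1)[OF RS(1,2)] RS by (auto simp: Un_absorb1 Un_absorb2)
  ultimately show ?case by blast
qed

locale infinite_basis = vector_space scale
  for scale :: "'f::field \<Rightarrow> 'v::ab_group_add \<Rightarrow> 'v" (infixr \<open>*s\<close> 75) +
  fixes B :: "'v set"
  assumes independent_B: "independent B" and span_B: "span B = UNIV" and infinite_B: "infinite B"
begin

interpretation self: vector_space_pair scale scale ..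

abbreviation endo :: "('v \<Rightarrow> 'v) \<Rightarrow> bool" where
  "endo f \<equiv> Vector_Spaces.linear scale scale f"

lemma endo_inv:
  assumes "endo x" "bij x"
  shows "endo (inv x)"
proof -
  have x: "x (inv x v) = v" "x v = x w \<Longrightarrow> v = w" for v w
    using assms(2) by (simp_all add: surj_f_inv_f bij_is_surj inj_eq bij_is_inj)
  have "inv x (a + b) = inv x a + inv x b" "inv x (c *s a) = c *s inv x a" for a b c
    by (rule x(2), simp add: x(1) self.linear_add[OF assms(1)] self.linear_scale[OF assms(1)])+
  then show ?thesis using vector_space_axioms by (auto simp: Vector_Spaces.linear_iff)
qed

section \<open>Systems of paths and prolongation of the domain\<close>

text \<open>Single-valuedness in both directions bounds in- and out-degrees by one; together with
  acyclicity the components are simple paths, possibly infinite in either direction.\<close>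

definition paths :: "('v \<times> 'v) set \<Rightarrow> bool" where
  "paths R \<longleftrightarrow> single_valued R \<and> single_valued (R\<inverse>) \<and> acyclic R \<and> independent (Field R)"

lemma paths_converse: "paths (R\<inverse>) \<longleftrightarrow> paths R"
  by (auto simp: paths_def acyclic_converse)

text \<open>The vectors of \<open>M\<close> have no outgoing edge yet and may themselves be new;
  their targets are fresh and distinct, so no cycle closes and no two paths merge.\<close>

lemma paths_extend:
  assumes R: "paths R" and M: "M \<inter> Domain R = {}" and h: "inj_on h M" "h ` M \<inter> (Field R \<union> M) = {}"
    and ind: "independent (Field R \<union> M \<union> h ` M)"
  shows "paths (R \<union> (\<lambda>s. (s, h s)) ` M)"
proof -
  let ?H = "(\<lambda>s. (s, h s)) ` M"
  have F: "Field (R \<union> ?H) = Field R \<union> M \<union> h ` M" by (auto simp: Field_def)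
  have "acyclic (R \<union> ?H)"
    using R h by (intro acyclic_Un_fresh_targets[where N = "h ` M"]) (auto simp: paths_def Field_def)
  moreover have "single_valued (R \<union> ?H)"
    using R M by (auto simp: paths_def single_valued_def)
  moreover have "single_valued ((R \<union> ?H)\<inverse>)"
    using R h by (auto simp: paths_def single_valued_def Field_def dest: inj_onD)
  ultimately show ?thesis using ind unfolding paths_def F by blast
qed

text \<open>
  The edges \<open>R\<close> are the known pairs \<open>(s, u s)\<close>, and \<open>Q\<close> the known pairs \<open>(t, v t)\<close> for
  \<open>v = u\<^sup>-\<^sup>1 x\<close>. Only the values of \<open>u\<close> on the span of \<open>Domain R\<close>, which is also the range of the
  partial map \<open>v\<close>, matter.
\<close>
definition factoring :: "('v \<Rightarrow> 'v) \<Rightarrow> ('v \<times> 'v) set \<Rightarrow> ('v \<times> 'v) set \<Rightarrow> bool" where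
  "factoring x R Q \<longleftrightarrow> paths R \<and> paths Q \<and> span (Domain R) = span (Range Q) \<and>
     (\<exists>u. endo u \<and> (\<forall>s s'. (s, s') \<in> R \<longrightarrow> u s = s') \<and> (\<forall>t t'. (t, t') \<in> Q \<longrightarrow> u t' = x t))"

text \<open>Both factors are prolonged by one map \<open>w\<close>, which sends the missing vectors
  to fresh basis vectors. Freshness of the new \<open>u\<close>-targets and of the new
  \<open>v\<close>-sources follows from the single kernel statement \<open>ker\<close>.\<close>

lemma factoring_extend_domain:
  assumes x: "endo x" "bij x" and K: "|K| <o |B|" and fac: "factoring x R Q"
    and small: "small K (Field R \<union> Field Q \<union> Y)"
  shows "\<exists>R' Q'. R \<subseteq> R' \<and> Q \<subseteq> Q' \<and> factoring x R' Q' \<and> Y \<subseteq> span (Domain R') \<and>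
    small K (Field R' \<union> Field Q')"
proof -
  from fac obtain u where pR: "paths R" and pQ: "paths Q" and dom: "span (Domain R) = span (Range Q)"
    and u: "endo u" "\<And>s s'. (s, s') \<in> R \<Longrightarrow> u s = s'" "\<And>t t'. (t, t') \<in> Q \<Longrightarrow> u t' = x t"
    unfolding factoring_def by blast
  define Z where "Z = Field R \<union> Field Q \<union> Y"
  \<comment> \<open>\<open>S\<close> and \<open>T\<close> are two bases of \<open>span Z\<close>,
    containing the vertices of \<open>R\<close> and of \<open>Q\<close>. They become
    \<open>Domain R'\<close> and \<open>Range Q'\<close>, which keeps the two spans equal.\<close>
  obtain S where S: "Field R \<subseteq> S" "S \<subseteq> Z" "independent S" "Z \<subseteq> span S"
    using maximal_independent_subset_extend[of "Field R" Z] pR unfolding paths_def Z_def by blast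
  obtain T where T: "Field Q \<subseteq> T" "T \<subseteq> Z" "independent T" "Z \<subseteq> span T"
    using maximal_independent_subset_extend[of "Field Q" Z] pQ unfolding paths_def Z_def by blast
  have spS: "span S = span Z" and spT: "span T = span Z"
    unfolding span_eq using S T span_superset[of Z] by blast+
  have smZ: "small K Z" using small by (simp add: Z_def)
  \<comment> \<open>\<open>C\<close> supports the image of \<open>Z\<close> under \<open>x\<close>
    as well: \<open>g y\<close> in \<open>span Z\<close> will have to force
    \<open>w y = x (g y)\<close> into \<open>span C\<close>.\<close>
  obtain C where C: "C \<subseteq> B" "small K C" "Z \<union> x ` Z \<subseteq> span C"
    using small_support[OF span_B small_Un[OF smZ small_image[OF smZ, of x]]] by blast
  have ZC: "span Z \<subseteq> span C" using C(3) by (intro span_minimal) auto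
  define M where "M = S - Domain R"
  have "M \<subseteq> Z" using S(2) by (auto simp: M_def)
  then have smM: "small K M" by (rule small_subset[OF smZ])
  obtain h where h: "inj_on h M" "h ` M \<subseteq> B - C"
    using inj_into_Diff_small[OF infinite_B K C(2) smM] by metis
  have DS: "Domain R \<subseteq> S" and RS: "Range R \<subseteq> S" using S(1) by (auto simp: Field_def)
  define w0 where "w0 s = (if s \<in> Domain R then u s else h s)" for s
  obtain w where w: "endo w" "\<forall>s\<in>S. w s = w0 s"
    using self.linear_independent_extend[OF S(3), of w0] by blast
  have wR: "w s = u s" if "s \<in> Domain R" for s using bspec[OF w(2) subsetD[OF DS that]] that by (simp add: w0_def)
  have wM: "w s = h s" if "s \<in> M" for s using that w(2) by (simp add: M_def w0_def)
  have w_old: "w s = u s" if "s \<in> span (Domain R)" for s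
    using self.linear_eq_on[OF w(1) u(1) that] wR by blast
  have indN: "independent (h ` M)" using h(2) independent_B independent_mono by blast
  have wN: "w ` M = h ` M" using wM by auto
  \<comment> \<open>The values of \<open>w\<close> on \<open>M\<close> are independent modulo \<open>span C\<close>.\<close>
  have ker: "y \<in> span (Domain R)" if y: "y \<in> span Z" "w y \<in> span C" for y
  proof -
    have "S = Domain R \<union> M" using DS by (auto simp: M_def)
    then obtain a b where ab: "y = a + b" "a \<in> span (Domain R)" "b \<in> span M"
      using y(1) unfolding spS[symmetric] by (auto simp: span_Un)
    have "u ` Domain R = Range R" using u(2) by force
    then have "w a \<in> span (Range R)"
      using ab(2) w_old[OF ab(2)] self.linear_span_image[OF u(1), of "Domain R"] by auto
    moreover have "Range R \<subseteq> Z" using RS S(2) by blast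
    ultimately have "w a \<in> span C" using ZC span_mono by blast
    then have "w b \<in> span C"
      using y(2) span_diff[of "w y" C "w a"] by (simp add: ab(1) self.linear_add[OF w(1)])
    moreover have "w b \<in> span (B - C)"
      using ab(3) self.linear_span_image[OF w(1), of M] span_mono[OF h(2)] wN by auto
    ultimately have "w b = 0" using span_Int_span_Diff[OF independent_B C(1)] by blast
    moreover have "inj_on w (span M)"
      using indN h(1) inj_on_cong[of M w h] wM
      by (intro self.linear_inj_on_span_independent_image[OF w(1)]) (simp_all add: wN)
    ultimately have "b = 0"
      using ab(3) self.linear_inj_on_iff_eq_0[OF w(1) subspace_span] by blast
    then show ?thesis using ab by simp
  qed
  have SD: "S - M = Domain R" using DS by (auto simp: M_def)
  define R' where "R' = R \<union> (\<lambda>s. (s, w s)) ` M"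
  have SC: "span S \<subseteq> span C" and MS: "M \<subseteq> S" using ZC spS by (simp_all add: M_def)
  have kerS: "y \<in> span (S - M)" if "y \<in> span S" "w y \<in> span C" for y
    using ker[of y] that by (simp add: SD spS)
  note newR = independent_Un_image[OF w(1) S(3) SC MS kerS]
  have "paths R'"
    unfolding R'_def
  proof (rule paths_extend[OF pR _ newR(1)])
    have SM: "Field R \<union> M = S" using S(1) by (auto simp: M_def Field_def)
    show "M \<inter> Domain R = {}" by (auto simp: M_def)
    show "w ` M \<inter> (Field R \<union> M) = {}"
      unfolding SM using newR(3) ZC spS span_superset[of S] by blast
    show "independent (Field R \<union> M \<union> w ` M)" unfolding SM by (rule newR(2))
  qed
  \<comment> \<open>Since \<open>u \<circ> v = x\<close>, the vector that \<open>v\<close> sends to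
    \<open>t\<close> is \<open>inv x (w t)\<close>; thus \<open>g\<close> plays the inverse of
    \<open>v\<close>.\<close>
  define g where "g = inv x \<circ> w"
  have xg: "x (g v) = w v" for v using x(2) by (simp add: g_def surj_f_inv_f bij_is_surj)
  have g: "endo g" unfolding g_def by (rule Vector_Spaces.linear_compose[OF w(1) endo_inv[OF x]])
  define L where "L = T - Range Q"
  have xZ: "x v \<in> span C" if "v \<in> span Z" for v
  proof -
    have "x v \<in> span (x ` Z)" using that self.linear_span_image[OF x(1)] by blast
    moreover have "span (x ` Z) \<subseteq> span C" using C(3) by (intro span_minimal) auto
    ultimately show ?thesis by blast
  qed
  have QT: "Domain Q \<subseteq> T" "Range Q \<subseteq> T" using T(1) by (auto simp: Field_def)
  have TL: "T - L = Range Q" using QT by (auto simp: L_def)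
  have TZ: "span T \<subseteq> span Z" and LT: "L \<subseteq> T" using spT by (simp_all add: L_def)
  have kerT: "y \<in> span (T - L)" if "y \<in> span T" "g y \<in> span Z" for y
    using that ker[of y] xZ[of "g y"] by (simp add: xg TL spT dom)
  note newQ = independent_Un_image[OF g T(3) TZ LT kerT]
  define Q' where "Q' = Q \<union> (\<lambda>t. (g t, t)) ` L"
  \<comment> \<open>The new \<open>Q\<close>-edges run from the fresh \<open>g t\<close> to
    \<open>t\<close>, so the prolongation is carried out for the converse relation.\<close>
  have "paths (Q\<inverse> \<union> (\<lambda>t. (t, g t)) ` L)"
  proof (rule paths_extend[OF _ _ newQ(1)])
    have SM: "Field (Q\<inverse>) \<union> L = T" using T(1) by (auto simp: L_def Field_def)
    show "paths (Q\<inverse>)" using pQ by (simp add: paths_converse)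
    show "L \<inter> Domain (Q\<inverse>) = {}" by (auto simp: L_def)
    show "g ` L \<inter> (Field (Q\<inverse>) \<union> L) = {}"
      unfolding SM using newQ(3) spT span_superset[of T] by blast
    show "independent (Field (Q\<inverse>) \<union> L \<union> g ` L)" unfolding SM by (rule newQ(2))
  qed
  moreover have "Q\<inverse> \<union> (\<lambda>t. (t, g t)) ` L = Q'\<inverse>" by (auto simp: Q'_def)
  ultimately have "paths Q'" by (simp add: paths_converse)
  have domR': "Domain R' = S" using DS by (auto simp: R'_def M_def)
  have "Range ((\<lambda>t. (g t, t)) ` L) = L" by force
  then have ranQ': "Range Q' = T" using QT(2) by (simp add: Q'_def Range_Un_eq L_def Un_absorb1)
  have "factoring x R' Q'"
    unfolding factoring_def domR' ranQ' spS spT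
  proof (intro conjI exI[of _ w])
    show "\<forall>s s'. (s, s') \<in> R' \<longrightarrow> w s = s'" using u(2) wR by (auto simp: R'_def)
    have "w t' = x t" if "(t, t') \<in> Q" for t t'
      using that u(3) w_old[of t'] dom span_base[of t' "Range Q"] by auto
    then show "\<forall>t t'. (t, t') \<in> Q' \<longrightarrow> w t' = x t" by (auto simp: Q'_def xg)
  qed (simp_all add: w(1) \<open>paths R'\<close> \<open>paths Q'\<close>)
  moreover have "Field R' \<union> Field Q' \<subseteq> Z \<union> w ` Z \<union> g ` Z"
    using S(2) T(2) by (auto simp: R'_def Q'_def Field_def Z_def M_def L_def)
  then have "small K (Field R' \<union> Field Q')"
    using small_Un[OF small_Un[OF smZ small_image[OF smZ]] small_image[OF smZ]]
    by (rule small_subset[rotated])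
  moreover have "Y \<subseteq> span (Domain R')" unfolding domR' spS by (auto simp: Z_def intro: span_base)
  ultimately show ?thesis by (intro exI[of _ R'] exI[of _ Q']) (auto simp: R'_def Q'_def)
qed

section \<open>Exchanging domain and range by inverting the automorphism\<close>

text \<open>
  If \<open>x = u v\<close>, then \<open>x\<^sup>-\<^sup>1 = u\<^sup>-\<^sup>1 (x v\<^sup>-\<^sup>1 x\<^sup>-\<^sup>1)\<close>; these are the edges of \<open>x v\<^sup>-\<^sup>1 x\<^sup>-\<^sup>1\<close>.
\<close>
definition conj_edges :: "('v \<Rightarrow> 'v) \<Rightarrow> ('v \<times> 'v) set \<Rightarrow> ('v \<times> 'v) set" where
  "conj_edges x Q = (\<lambda>(t, t'). (x t', x t)) ` Q"

lemma conj_edges_iff: "(a, b) \<in> conj_edges x Q \<longleftrightarrow> (\<exists>t t'. (t, t') \<in> Q \<and> a = x t' \<and> b = x t)"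
  by (auto simp: conj_edges_def)

lemma conj_edges_inv: "bij x \<Longrightarrow> conj_edges (inv x) (conj_edges x Q) = Q"
  by (force simp: conj_edges_def image_image split_beta bij_is_inj)

lemma Field_conj_edges: "Field (conj_edges x Q) = x ` Field Q"
  by (force simp: conj_edges_def Field_def)

text \<open>As \<open>x\<close> is injective and linear, this is the converse of \<open>Q\<close>
  transported along \<open>x\<close>, and all four conditions survive reversal and
  relabelling.\<close>

lemma paths_conj_edges:
  assumes x: "endo x" "bij x" and Q: "paths Q"
  shows "paths (conj_edges x Q)"
proof -
  have inj: "x a = x b \<longleftrightarrow> a = b" for a b using x(2) by (simp add: bij_is_inj inj_eq)
  have "independent (Field (conj_edges x Q))"
    unfolding Field_conj_edges using Q x
    by (intro self.linear_independent_injective_image) (auto simp: paths_def inj_on_def bij_def)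
  moreover have "single_valued (conj_edges x Q)" "single_valued ((conj_edges x Q)\<inverse>)"
    using Q by (auto simp: paths_def single_valued_def conj_edges_iff inj)
  moreover have "acyclic (conj_edges x Q)"
  proof -
    have *: "\<exists>t t'. a = x t' \<and> b = x t \<and> (t, t') \<in> Q\<^sup>+" if "(a, b) \<in> (conj_edges x Q)\<^sup>+" for a b
      using that
    proof (induction rule: trancl_induct)
      case (base b)
      then show ?case unfolding conj_edges_iff by blast
    next
      case (step b c)
      from step.hyps(2) obtain s s' where s: "(s, s') \<in> Q" "b = x s'" "c = x s"
        unfolding conj_edges_iff by blast
      from step.IH obtain t t' where t: "a = x t'" "b = x t" "(t, t') \<in> Q\<^sup>+" by blast
      then have "(s, t') \<in> Q\<^sup>+" using s inj[of s' t] by (simp add: trancl_into_trancl2)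
      then show ?case using s t by blast
    qed
    show ?thesis
      unfolding acyclic_def
    proof (intro allI notI)
      fix a assume "(a, a) \<in> (conj_edges x Q)\<^sup>+"
      then obtain t t' where "a = x t'" "a = x t" "(t, t') \<in> Q\<^sup>+" using * by blast
      then show False using Q inj[of t t'] by (simp add: paths_def acyclic_def)
    qed
  qed
  ultimately show ?thesis by (simp add: paths_def)
qed

text \<open>The map \<open>u\<close> is injective on \<open>Domain R\<close>; its inverse there is
  prescribed on the independent set \<open>Range R\<close> and extended linearly. The span condition
  is carried over by \<open>u\<close>, which maps \<open>Range Q\<close> onto the image of
  \<open>Domain Q\<close> under \<open>x\<close>.\<close>

lemma factoring_inverse:
  assumes x: "endo x" "bij x" and fac: "factoring x R Q"
  shows "factoring (inv x) (R\<inverse>) (conj_edges x Q)"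
proof -
  from fac obtain u where pR: "paths R" and pQ: "paths Q" and dom: "span (Domain R) = span (Range Q)"
    and u: "endo u" "\<And>s s'. (s, s') \<in> R \<Longrightarrow> u s = s'" "\<And>t t'. (t, t') \<in> Q \<Longrightarrow> u t' = x t"
    unfolding factoring_def by blast
  have invx: "inv x (x v) = v" for v using x(2) by (simp add: bij_is_inj)
  have uR: "u ` Domain R = Range R" using u(2) by force
  have "independent (Range R)"
    using pR independent_mono[of "Field R" "Range R"] by (auto simp: paths_def Field_def)
  then obtain w where w: "endo w" "\<forall>s'\<in>Range R. w s' = inv_into (Domain R) u s'"
    using self.linear_independent_extend[of "Range R" "inv_into (Domain R) u"] by blast
  have inj: "inj_on u (Domain R)"
    using pR u(2) by (auto simp: inj_on_def paths_def single_valued_def)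
  have wR: "w s' = s" if "(s, s') \<in> R" for s s'
  proof -
    have "s' = u s" "s \<in> Domain R" "s' \<in> Range R" using that u(2) by auto
    then show ?thesis using w(2) inv_into_f_f[OF inj] by simp
  qed
  have wu: "w (u s) = s" if "s \<in> span (Domain R)" for s
  proof -
    have "(w \<circ> u) b = id b" if b: "b \<in> Domain R" for b
    proof -
      from b obtain b' where "(b, b') \<in> R" by blast
      then show ?thesis using wR[of b b'] u(2)[of b b'] by simp
    qed
    from self.linear_eq_on[OF Vector_Spaces.linear_compose[OF u(1) w(1)] linear_id that this]
    show ?thesis by simp
  qed
  show ?thesis
    unfolding factoring_def
  proof (intro conjI exI[of _ w] allI impI)
    show "paths (R\<inverse>)" using pR by (simp add: paths_converse)
    show "paths (conj_edges x Q)" by (rule paths_conj_edges[OF x pQ])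
    have "Range (conj_edges x Q) = x ` Domain Q" by (force simp: conj_edges_def)
    also have "x ` Domain Q = u ` Range Q" using u(3) by force
    finally show "span (Domain (R\<inverse>)) = span (Range (conj_edges x Q))"
      using uR dom self.linear_span_image[OF u(1)] by (metis Domain_converse)
    show "w s = s'" if "(s, s') \<in> R\<inverse>" for s s' using that wR by simp
    show "w t' = inv x t" if "(t, t') \<in> conj_edges x Q" for t t'
    proof -
      obtain q q' where q: "(q, q') \<in> Q" "t = x q'" "t' = x q" using \<open>(t, t') \<in> _\<close> conj_edges_iff by metis
      then have "q' \<in> span (Domain R)" using dom span_base[of q' "Range Q"] by auto
      then show ?thesis using wu[of q'] u(3)[OF q(1)] q by (simp add: invx)
    qed
  qed fact
qed

text \<open>Domain prolongation for \<open>inv x\<close>, inverted back. Conjugating edges by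
  \<open>x\<close> and then by \<open>inv x\<close> restores them, so the old \<open>Q\<close> is
  kept.\<close>

lemma factoring_extend_range:
  assumes x: "endo x" "bij x" and K: "|K| <o |B|" and fac: "factoring x R Q"
    and small: "small K (Field R \<union> Field Q \<union> Y)"
  shows "\<exists>R' Q'. R \<subseteq> R' \<and> Q \<subseteq> Q' \<and> factoring x R' Q' \<and> Y \<subseteq> span (Range R') \<and>
    small K (Field R' \<union> Field Q')"
proof -
  have ix: "endo (inv x)" "bij (inv x)" "inv (inv x) = x"
    using x by (simp_all add: endo_inv bij_imp_bij_inv inv_inv_eq)
  have "small K (Field (R\<inverse>) \<union> Field (conj_edges x Q) \<union> Y)"
  proof -
    have "small K (Field R)" "small K (Field Q)" "small K Y"
      by (rule small_subset[OF small]; blast)+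
    then show ?thesis unfolding Field_conj_edges Field_converse by (intro small_Un small_image)
  qed
  from factoring_extend_domain[OF ix(1,2) K factoring_inverse[OF x fac] this]
  obtain P T where P: "R\<inverse> \<subseteq> P" "conj_edges x Q \<subseteq> T" "factoring (inv x) P T" "Y \<subseteq> span (Domain P)"
    "small K (Field P \<union> Field T)" by blast
  have "factoring x (P\<inverse>) (conj_edges (inv x) T)"
    using factoring_inverse[OF ix(1,2) P(3)] ix(3) by simp
  moreover have "Q \<subseteq> conj_edges (inv x) T"
  proof -
    have "conj_edges (inv x) (conj_edges x Q) \<subseteq> conj_edges (inv x) T"
      using P(2) unfolding conj_edges_def by (rule image_mono)
    then show ?thesis using conj_edges_inv[OF x(2)] by simp
  qed
  moreover have "small K (Field (P\<inverse>) \<union> Field (conj_edges (inv x) T))"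
  proof -
    have "small K (Field P)" "small K (Field T)"
      by (rule small_subset[OF P(5)]; blast)+
    then show ?thesis unfolding Field_conj_edges Field_converse by (intro small_Un small_image)
  qed
  moreover have "R \<subseteq> P\<inverse>" "Y \<subseteq> span (Range (P\<inverse>))" using P(1,4) by auto
  ultimately show ?thesis by blast
qed

section \<open>Unions of chains of partial factorizations\<close>

text \<open>Every violation, be it a cycle, a branching or a linear dependence, involves finitely
  many edges and so already occurs in one member of the chain.\<close>

lemma paths_chain:
  assumes chain: "\<And>R S. R \<in> C \<Longrightarrow> S \<in> C \<Longrightarrow> R \<subseteq> S \<or> S \<subseteq> R" and paths: "\<And>R. R \<in> C \<Longrightarrow> paths R"
  shows "paths (\<Union>C)"
proof -
  have "acyclic (\<Union>C)"
    unfolding acyclic_def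
  proof (intro allI notI)
    fix a assume "(a, a) \<in> (\<Union>C)\<^sup>+"
    from chain_Un_trancl[OF chain this] obtain R where "R \<in> C" "(a, a) \<in> R\<^sup>+" by blast
    then show False using paths[of R] by (simp add: paths_def acyclic_def)
  qed
  moreover have "single_valued (\<Union>C)" "single_valued ((\<Union>C)\<inverse>)"
  proof -
    have "y = z" if "(a, y) \<in> R" "(a, z) \<in> S" "R \<in> C" "S \<in> C" for a y z R S
      using chain[OF that(3,4)] that paths[of R] paths[of S] by (auto simp: paths_def dest: single_valuedD)
    then show "single_valued (\<Union>C)" by (auto intro!: single_valuedI)
    have "y = z" if "(y, a) \<in> R" "(z, a) \<in> S" "R \<in> C" "S \<in> C" for a y z R S
      using chain[OF that(3,4)] that paths[of R] paths[of S]
      by (auto simp: paths_def single_valued_def)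
    then show "single_valued ((\<Union>C)\<inverse>)" by (auto intro!: single_valuedI)
  qed
  moreover have "independent (Field (\<Union>C))"
  proof -
    have "Field (\<Union>C) = \<Union>(Field ` C)" by (auto simp: Field_def)
    moreover have "independent (\<Union>(Field ` C))"
    proof (rule independent_Union_directed)
      fix c d assume "c \<in> Field ` C" "d \<in> Field ` C"
      then obtain R S where "c = Field R" "d = Field S" "R \<in> C" "S \<in> C" by blast
      then show "c \<subseteq> d \<or> d \<subseteq> c" using chain[of R S] mono_Field[of R S] mono_Field[of S R] by blast
    qed (use paths in \<open>auto simp: paths_def\<close>)
    ultimately show ?thesis by simp
  qed
  ultimately show ?thesis by (simp add: paths_def)
qed

text \<open>The maps witnessing the single stages may disagree outside their domain spans, so a new
  \<open>u\<close> is extended linearly from the united edges. It agrees with the map of stage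
  \<open>i\<close> on \<open>span (Domain (R i))\<close>, which contains
  \<open>Range (Q i)\<close>.\<close>

lemma factoring_chain:
  assumes chain: "\<And>i j. i \<in> I \<Longrightarrow> j \<in> I \<Longrightarrow> (R i \<subseteq> R j \<and> Q i \<subseteq> Q j) \<or> (R j \<subseteq> R i \<and> Q j \<subseteq> Q i)"
    and fac: "\<And>i. i \<in> I \<Longrightarrow> factoring x (R i) (Q i)"
  shows "factoring x (\<Union>i\<in>I. R i) (\<Union>i\<in>I. Q i)"
proof -
  let ?R = "\<Union>i\<in>I. R i" and ?Q = "\<Union>i\<in>I. Q i"
  have pR: "paths ?R"
    by (rule paths_chain) (use chain fac in \<open>auto simp: factoring_def\<close>)
  have pQ: "paths ?Q"
    by (rule paths_chain) (use chain fac in \<open>auto simp: factoring_def\<close>)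
  have dom_i: "span (Domain (R i)) = span (Range (Q i))" if "i \<in> I" for i
    using fac[OF that] by (simp add: factoring_def)
  have mono: "span (Domain (R i)) \<subseteq> span (Domain ?R)" "span (Range (Q i)) \<subseteq> span (Range ?Q)" if "i \<in> I" for i
    using that by (intro span_mono Domain_mono Range_mono; blast)+
  have "Domain ?R \<subseteq> span (Range ?Q)"
  proof
    fix a assume "a \<in> Domain ?R"
    then obtain i where i: "i \<in> I" "a \<in> Domain (R i)" by blast
    then have "a \<in> span (Range (Q i))" using dom_i[OF i(1)] span_base[of a "Domain (R i)"] by blast
    then show "a \<in> span (Range ?Q)" using mono(2)[OF i(1)] by blast
  qed
  moreover have "Range ?Q \<subseteq> span (Domain ?R)"
  proof
    fix a assume "a \<in> Range ?Q"
    then obtain i where i: "i \<in> I" "a \<in> Range (Q i)" by blast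
    then have "a \<in> span (Domain (R i))" using dom_i[OF i(1)] span_base[of a "Range (Q i)"] by blast
    then show "a \<in> span (Domain ?R)" using mono(1)[OF i(1)] by blast
  qed
  ultimately have dom: "span (Domain ?R) = span (Range ?Q)" by (simp add: span_eq)
  have "independent (Domain ?R)"
    using pR independent_mono[of "Field ?R" "Domain ?R"] by (simp add: paths_def Field_def)
  then obtain u where u: "endo u" "\<forall>s\<in>Domain ?R. u s = (THE s'. (s, s') \<in> ?R)"
    using self.linear_independent_extend[of "Domain ?R" "\<lambda>s. THE s'. (s, s') \<in> ?R"] by blast
  have uR: "u s = s'" if "(s, s') \<in> ?R" for s s'
  proof -
    have "(THE s'. (s, s') \<in> ?R) = s'"
      using that pR by (intro the_equality) (auto simp: paths_def dest: single_valuedD)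
    moreover have "s \<in> Domain ?R" using that by (rule DomainI)
    ultimately show ?thesis using u(2) by simp
  qed
  have uQ: "u t' = x t" if t: "(t, t') \<in> ?Q" for t t'
  proof -
    obtain i where i: "i \<in> I" "(t, t') \<in> Q i" using t by blast
    then obtain w where w: "endo w" "\<And>s s'. (s, s') \<in> R i \<Longrightarrow> w s = s'" "w t' = x t"
      using fac unfolding factoring_def by blast
    have "t' \<in> span (Domain (R i))" using dom_i[OF i(1)] i(2) span_base[of t' "Range (Q i)"] by blast
    moreover have "u s = w s" if s: "s \<in> Domain (R i)" for s
    proof -
      obtain s' where "(s, s') \<in> R i" using s by blast
      then show ?thesis using uR[of s s'] w(2)[of s s'] i(1) by auto
    qed
    ultimately have "u t' = w t'" by (rule self.linear_eq_on[OF u(1) w(1)])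
    then show ?thesis using w(3) by simp
  qed
  show ?thesis unfolding factoring_def using pR pQ dom u(1) uR uQ by blast
qed

subsection \<open>Automorphisms as products of two shifts\<close>

lemma factoring_exists:
  assumes x: "endo x" "bij x"
  shows "\<exists>R Q. factoring x R Q \<and> span (Domain R) = UNIV \<and> span (Range R) = UNIV"
proof -
  \<comment> \<open>In the cardinal well-order each proper initial segment is strictly smaller than
    \<open>B\<close>, so a stage bounded by its initial segment always leaves fresh basis
    vectors.\<close>
  define r where "r = |B|"
  have wo: "well_order_on B r" unfolding r_def by (rule card_of_well_order_on)
  have field_r: "Field r = B" by (simp add: r_def Field_card_of)
  have total: "(a, b) \<in> r \<or> (b, a) \<in> r \<or> a = b" if "a \<in> B" "b \<in> B" for a b
    using wo that by (auto simp: well_order_on_def linear_order_on_def total_on_def)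
  have trans: "trans r" and antisym: "antisym r"
    using wo by (auto simp: well_order_on_def linear_order_on_def partial_order_on_def preorder_on_def)
  have underS_B: "underS r a \<subseteq> B" for a using field_r by (auto simp: underS_def Field_def)
  \<comment> \<open>\<open>f b\<close> is the pair of edge sets of stage \<open>b\<close>.
    \<open>P\<close> reads \<open>f\<close> only on \<open>underS r a\<close>, as the recursion
    demands, and is vacuous off \<open>B\<close>.\<close>
  define P where "P f a s \<longleftrightarrow> (a \<in> B \<longrightarrow> factoring x (fst s) (snd s) \<and>
      (\<forall>b\<in>underS r a. fst (f b) \<subseteq> fst s \<and> snd (f b) \<subseteq> snd s) \<and>
      a \<in> span (Domain (fst s)) \<and> a \<in> span (Range (fst s)) \<and>
      small (underS r a) (Field (fst s) \<union> Field (snd s)))"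
    for f :: "'v \<Rightarrow> ('v \<times> 'v) set \<times> ('v \<times> 'v) set" and a s
  have nested: "(fst (f i) \<subseteq> fst (f j) \<and> snd (f i) \<subseteq> snd (f j)) \<or> (fst (f j) \<subseteq> fst (f i) \<and> snd (f j) \<subseteq> snd (f i))"
    if ij: "i \<in> B" "j \<in> B" and P: "P f i (f i)" "P f j (f j)" for f i j
  proof (cases "i = j")
    case False
    then consider "i \<in> underS r j" | "j \<in> underS r i" using total[OF ij] by (auto simp: underS_def)
    then show ?thesis
    proof cases
      case 1 then show ?thesis using P(2) ij unfolding P_def by simp
    next
      case 2 then show ?thesis using P(1) ij unfolding P_def by simp
    qed
  qed simp
  have "\<exists>f. \<forall>a. P f a (f a)"
  proof (rule dependent_wf_choice)
    show "wf (r - Id)" using wo by (simp add: well_order_on_def)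
  next
    fix f g :: "'v \<Rightarrow> ('v \<times> 'v) set \<times> ('v \<times> 'v) set" and a s
    assume "\<And>b. (b, a) \<in> r - Id \<Longrightarrow> f b = g b"
    then have "f b = g b" if "b \<in> underS r a" for b using that by (auto simp: underS_def)
    then show "P f a s = P g a s" by (simp add: P_def)
  next
    fix a f
    assume IH: "\<And>b. (b, a) \<in> r - Id \<Longrightarrow> P f b (f b)"
    show "\<exists>s. P f a s"
    proof (cases "a \<in> B")
      case False
      then show ?thesis by (simp add: P_def)
    next
      case a: True
      let ?I = "underS r a"
      \<comment> \<open>Starting from the union of all earlier stages treats the first stage (empty
        edge sets), successors and limits alike.\<close>
      let ?R = "\<Union>b\<in>?I. fst (f b)" and ?Q = "\<Union>b\<in>?I. snd (f b)"
      have Pb: "P f b (f b)" if "b \<in> ?I" for b using that IH[of b] by (simp add: underS_def)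
      have inB: "b \<in> B" if "b \<in> ?I" for b using that underS_B by blast
      have "factoring x ?R ?Q"
      proof (rule factoring_chain)
        show "factoring x (fst (f b)) (snd (f b))" if "b \<in> ?I" for b
          using Pb[OF that] inB[OF that] by (simp add: P_def)
        show "fst (f i) \<subseteq> fst (f j) \<and> snd (f i) \<subseteq> snd (f j) \<or> fst (f j) \<subseteq> fst (f i) \<and> snd (f j) \<subseteq> snd (f i)"
          if "i \<in> ?I" "j \<in> ?I" for i j
          using nested[of i j f] that Pb inB by blast
      qed
      moreover have "small ?I (Field ?R \<union> Field ?Q \<union> {a})"
      proof -
        \<comment> \<open>Each earlier bound, relative to a smaller initial segment, is weakened to
          \<open>?I\<close>; a union of small sets indexed by \<open>?I\<close> is again
          small.\<close>
        have "small ?I (\<Union>b\<in>?I. Field (fst (f b)) \<union> Field (snd (f b)))"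
        proof (rule small_UN[OF small_self])
          fix b assume b: "b \<in> ?I"
          then have "underS r b \<subseteq> ?I"
            using trans antisym by (intro underS_incr) (auto simp: underS_def)
          then show "small ?I (Field (fst (f b)) \<union> Field (snd (f b)))"
            using Pb[OF b] inB[OF b] small_mono by (auto simp: P_def)
        qed
        then have "small ?I ((\<Union>b\<in>?I. Field (fst (f b)) \<union> Field (snd (f b))) \<union> {a})"
          by (rule small_Un) (simp add: finite_imp_small)
        then show ?thesis by (rule small_subset) (auto simp: Field_def)
      qed
      moreover have less: "|?I| <o |B|"
        using card_of_underS[of r a] a field_r card_of_Card_order[of B] by (simp add: r_def)
      ultimately obtain R' Q' where 1: "?R \<subseteq> R'" "?Q \<subseteq> Q'" "factoring x R' Q'" "{a} \<subseteq> span (Domain R')"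
          "small ?I (Field R' \<union> Field Q')"
        using factoring_extend_domain[OF x less] by meson
      have "small ?I (Field R' \<union> Field Q' \<union> {a})"
        using 1(5) by (rule small_Un) (simp add: finite_imp_small)
      then obtain R'' Q'' where 2: "R' \<subseteq> R''" "Q' \<subseteq> Q''" "factoring x R'' Q''" "{a} \<subseteq> span (Range R'')"
          "small ?I (Field R'' \<union> Field Q'')"
        using factoring_extend_range[OF x less 1(3)] by meson
      have "a \<in> span (Domain R'')" using 1(4) span_mono[OF Domain_mono[OF 2(1)]] by blast
      moreover have "\<forall>b\<in>?I. fst (f b) \<subseteq> R'' \<and> snd (f b) \<subseteq> Q''" using 1(1,2) 2(1,2) by blast
      ultimately have "P f a (R'', Q'')" using 2 by (simp add: P_def)
      then show ?thesis by blast
    qed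
  qed
  then obtain f where f: "P f a (f a)" for a by blast
  let ?R = "\<Union>b\<in>B. fst (f b)" and ?Q = "\<Union>b\<in>B. snd (f b)"
  have fac: "factoring x ?R ?Q"
  proof (rule factoring_chain)
    show "factoring x (fst (f b)) (snd (f b))" if "b \<in> B" for b using f[of b] that by (simp add: P_def)
    show "fst (f i) \<subseteq> fst (f j) \<and> snd (f i) \<subseteq> snd (f j) \<or> fst (f j) \<subseteq> fst (f i) \<and> snd (f j) \<subseteq> snd (f i)"
      if "i \<in> B" "j \<in> B" for i j
      using nested[OF that] f by blast
  qed
  have "b \<in> span (Domain ?R) \<and> b \<in> span (Range ?R)" if b: "b \<in> B" for b
  proof -
    have "fst (f b) \<subseteq> ?R" using b by blast
    then have "span (Domain (fst (f b))) \<subseteq> span (Domain ?R)" "span (Range (fst (f b))) \<subseteq> span (Range ?R)"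
      by (simp_all add: span_mono Domain_mono Range_mono)
    then show ?thesis using f[of b] b by (auto simp: P_def)
  qed
  then have "B \<subseteq> span (Domain ?R)" "B \<subseteq> span (Range ?R)" by blast+
  then have "span B \<subseteq> span (Domain ?R)" "span B \<subseteq> span (Range ?R)"
    by (simp_all add: span_minimal)
  then have "span (Domain ?R) = UNIV" "span (Range ?R) = UNIV" by (simp_all add: span_B top.extremum_unique)
  then show ?thesis using fac by blast
qed

definition shift :: "('v \<Rightarrow> 'v) \<Rightarrow> bool" where
  "shift u \<longleftrightarrow> endo u \<and> bij u \<and>
     (\<exists>S. independent S \<and> span S = UNIV \<and> u ` S = S \<and> (\<forall>s\<in>S. \<forall>n>0. (u ^^ n) s \<noteq> s))"

text \<open>Domain and range are spanning subsets of the independent set \<open>Field R\<close>,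
  hence equal to it. So every vertex has a successor and a predecessor, \<open>u\<close> permutes
  \<open>Field R\<close>, and acyclicity rules out finite orbits.\<close>

lemma paths_imp_shift:
  assumes R: "paths R" "span (Domain R) = UNIV" "span (Range R) = UNIV"
    and u: "endo u" "\<And>s s'. (s, s') \<in> R \<Longrightarrow> u s = s'"
  shows "shift u"
proof -
  let ?S = "Field R"
  have ind: "independent ?S" using R(1) by (simp add: paths_def)
  have dom: "Domain R = ?S" and ran: "Range R = ?S"
    using independent_subset_eq_spanning[OF ind] R(2,3) by (auto simp: Field_def)
  have edge: "(s, u s) \<in> R" if s: "s \<in> ?S" for s
  proof -
    obtain s' where "(s, s') \<in> R" using s dom by blast
    then show ?thesis using u(2)[of s s'] by simp
  qed
  have img: "u ` ?S = ?S"
  proof (intro equalityI subsetI)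
    fix t assume "t \<in> u ` ?S"
    then show "t \<in> ?S" using edge ran by blast
  next
    fix t assume "t \<in> ?S"
    then obtain s where "(s, t) \<in> R" using ran by blast
    then show "t \<in> u ` ?S" using u(2)[of s t] dom by blast
  qed
  have "inj_on u ?S"
    using edge R(1) by (intro inj_onI) (auto simp: paths_def single_valued_def, metis)
  then have "inj_on u (span ?S)"
    using ind img by (intro self.linear_inj_on_span_independent_image[OF u(1)]) simp_all
  moreover have spS: "span ?S = UNIV" using R(2) dom by simp
  moreover have "range u = UNIV"
    using self.linear_span_image[OF u(1), of ?S] img spS by simp
  ultimately have "bij u" by (simp add: bij_def)
  moreover have "(u ^^ n) s \<noteq> s" if "s \<in> ?S" "n > 0" for s n
  proof -
    have "(u ^^ n) s \<in> ?S \<and> (n > 0 \<longrightarrow> (s, (u ^^ n) s) \<in> R\<^sup>+)"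
    proof (induction n)
      case (Suc n)
      then have "((u ^^ n) s, u ((u ^^ n) s)) \<in> R" using edge by blast
      moreover from this have "u ((u ^^ n) s) \<in> ?S" using ran by blast
      ultimately show ?case using Suc by (cases n) (auto intro: trancl_into_trancl)
    qed (use that in simp)
    then show ?thesis using that(2) R(1) by (auto simp: paths_def acyclic_def)
  qed
  ultimately show ?thesis
    unfolding shift_def using u(1) ind img spS by (intro conjI exI[of _ ?S]) simp_all
qed

text \<open>Only \<open>u\<close> comes out of the construction as a map of the whole space; the
  second factor is then forced to be \<open>inv u \<circ> x\<close>, and the edges \<open>Q\<close>
  exhibit it as a shift.\<close>

lemma automorphism_eq_shift_comp_shift:
  assumes x: "endo x" "bij x"
  shows "\<exists>u v. shift u \<and> shift v \<and> x = u \<circ> v"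
proof -
  obtain R Q where fac: "factoring x R Q" and R: "span (Domain R) = UNIV" "span (Range R) = UNIV"
    using factoring_exists[OF x] by blast
  then obtain u where pR: "paths R" and pQ: "paths Q" and dom: "span (Domain R) = span (Range Q)"
    and u: "endo u" "\<And>s s'. (s, s') \<in> R \<Longrightarrow> u s = s'" "\<And>t t'. (t, t') \<in> Q \<Longrightarrow> u t' = x t"
    unfolding factoring_def by blast
  have shu: "shift u" by (rule paths_imp_shift[OF pR R u(1,2)])
  then have bu: "bij u" by (simp add: shift_def)
  have uinv: "u (inv u v) = v" "inv u (u v) = v" for v
    using bu by (simp_all add: surj_f_inv_f bij_is_surj bij_is_inj)
  \<comment> \<open>The values of \<open>u\<close> on \<open>Range Q\<close> are those of
    \<open>x\<close> on \<open>Domain Q\<close>; bijectivity of both maps then makes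
    \<open>Domain Q\<close> spanning.\<close>
  have "x ` Domain Q = u ` Range Q" using u(3) by force
  then have "x ` span (Domain Q) = u ` span (Range Q)"
    using self.linear_span_image[OF x(1), of "Domain Q"] self.linear_span_image[OF u(1), of "Range Q"] by simp
  also have "\<dots> = x ` UNIV" using dom R(1) bu x(2) by (simp add: bij_is_surj)
  finally have domQ: "span (Domain Q) = UNIV" using x(2) by (simp add: inj_image_eq_iff bij_is_inj)
  have "shift (inv u \<circ> x)"
  proof (rule paths_imp_shift[OF pQ domQ])
    show "span (Range Q) = UNIV" using dom R(1) by simp
    show "endo (inv u \<circ> x)" by (rule Vector_Spaces.linear_compose[OF x(1) endo_inv[OF u(1) bu]])
    show "(inv u \<circ> x) t = t'" if "(t, t') \<in> Q" for t t'
      using uinv(2)[of t'] u(3)[OF that] by simp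
  qed
  moreover have "x = u \<circ> (inv u \<circ> x)" by (simp add: fun_eq_iff uinv)
  ultimately show ?thesis using shu by blast
qed

subsection \<open>Shifts as products of two quadratic maps\<close>

lemma endo_combination: "endo a \<Longrightarrow> endo (\<lambda>v. c *s a v - d *s v)"
  by (intro self.linear_compose_sub self.linear_compose_scale_right linear_scale_self)

text \<open>The quadratics are \<open>t^2 - s1 t + q1\<close> and \<open>t^2 - s2 t + q2\<close>,
  and \<open>r\<close> is a root of the second. Both maps are prescribed on a basis
  \<open>f\<close>, on which the three identities are then checked.\<close>

lemma shift_eq_comp_quadratic:
  assumes u: "shift u" and q: "q1 \<noteq> 0" "q2 \<noteq> 0" and r: "r * r = s2 * r - q2"
  shows "\<exists>a b. endo a \<and> endo b \<and> (\<forall>v. a (a v) = s1 *s a v - q1 *s v) \<and>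
    (\<forall>v. b (b v) = s2 *s b v - q2 *s v) \<and> u = a \<circ> b"
proof -
  from u obtain S where lin: "endo u" and bij: "bij u" and S: "independent S" "span S = UNIV" "u ` S = S"
    and free: "\<forall>s\<in>S. \<forall>n>0. (u ^^ n) s \<noteq> s"
    unfolding shift_def by (elim conjE exE)
  have r0: "r \<noteq> 0" using r q by auto
  have lin': "endo (inv u)" using lin bij by (rule endo_inv)
  have u_inv: "u (inv u v) = v" for v using bij by (simp add: surj_f_inv_f bij_is_surj)
  note [simp] = zpow_0[OF bij]
  define e where "e = (\<lambda>(i, n). zpow u n i)"
  obtain X where X: "inj_on e (X \<times> UNIV)" "e ` (X \<times> UNIV) = S"
    using orbit_representatives[OF bij S(3)] free unfolding e_def by metis
  txt \<open>
    The companion blocks of \<open>a\<close> live on \<open>f\<^sub>n, f\<^sub>1\<^sub>-\<^sub>n\<close> for \<open>n \<le> 0\<close>, those of \<open>b\<close> on \<open>f\<^sub>n, f\<^sub>-\<^sub>n\<close> for \<open>n > 0\<close>, and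
    \<open>f\<^sub>0\<close> is an eigenvector of \<open>b\<close>. Solving \<open>u = a \<circ> b\<close> for the \<open>f\<^sub>n\<close> gives the recursion for
    \<open>f\<^sub>-\<^sub>k\<close>, called \<open>g i k\<close> here.
  \<close>
  define c where "c = q1 * q2"
  define g where "g i = rec_nat i (\<lambda>k w. c *s inv u w - (q2 * s1 / r) *s zpow u (int k) i
      + (s2 / r) *s zpow u (int k + 1) i)" for i
  have g_0: "g i 0 = i" and g_Suc: "g i (Suc k) = c *s inv u (g i k) - (q2 * s1 / r) *s zpow u (int k) i
      + (s2 / r) *s zpow u (int k + 1) i" for i k
    by (simp_all add: g_def)
  \<comment> \<open>For \<open>n > 0\<close> the blocks force
    \<open>u f\<^sub>n = f\<^sub>n\<^sub>+\<^sub>1\<close>, and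
    \<open>u f\<^sub>0 = a (r f\<^sub>0) = r f\<^sub>1\<close>; hence the factor
    \<open>1 / r\<close> on positive indices.\<close>
  define f where "f = (\<lambda>(i, n). if 0 < n then (1 / r) *s zpow u n i else g i (nat (- n)))"
  \<comment> \<open>The rank lists the integers as 0, 1, -1, 2, -2, ..., in the same way for every
    orbit.\<close>
  define \<rho> where "\<rho> = (\<lambda>(i :: 'v, n). nat (if 0 < n then 2 * n - 1 else - 2 * n))"
  define \<kappa> where "\<kappa> = (\<lambda>(i :: 'v, n). if 0 < n then 1 / r else c ^ nat (- n))"
  \<comment> \<open>The half-open interval holds exactly the integers of rank below
    \<open>2 * k\<close>, the rank of \<open>- k\<close>.\<close>
  have g_lead: "g i k - c ^ k *s zpow u (- int k) i \<in> span ((\<lambda>n. zpow u n i) ` {- int k<..int k})" for i k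
  proof (induction k)
    case 0
    then show ?case by (simp add: g_0)
  next
    case (Suc k)
    let ?z = "\<lambda>n. zpow u n i"
    let ?W = "span (?z ` {- int (Suc k)<..int (Suc k)})"
    have "inv u ` ?z ` {- int k<..int k} \<subseteq> ?z ` {- int (Suc k)<..int (Suc k)}"
    proof clarify
      fix n assume "n \<in> {- int k<..int k}"
      then show "inv u (?z n) \<in> ?z ` {- int (Suc k)<..int (Suc k)}"
        by (intro image_eqI[of _ _ "n - 1"]) (auto simp: zpow_pred[OF bij])
    qed
    then have "inv u ` span (?z ` {- int k<..int k}) \<subseteq> ?W"
      unfolding self.linear_span_image[OF lin', symmetric] by (rule span_mono)
    then have "inv u (g i k - c ^ k *s ?z (- int k)) \<in> ?W" using Suc by blast
    moreover have "inv u (?z (- int k)) = ?z (- int (Suc k))"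
    proof -
      have "- int (Suc k) = - int k - 1" by simp
      then show ?thesis by (simp only: zpow_pred[OF bij])
    qed
    ultimately have 1: "inv u (g i k) - c ^ k *s ?z (- int (Suc k)) \<in> ?W"
      by (simp add: self.linear_diff[OF lin'] self.linear_scale[OF lin'])
    have 2: "?z (int k) \<in> ?W" "?z (int k + 1) \<in> ?W" by (intro span_base imageI; simp)+
    have "c *s (inv u (g i k) - c ^ k *s ?z (- int (Suc k))) - (q2 * s1 / r) *s ?z (int k)
        + (s2 / r) *s ?z (int k + 1) \<in> ?W"
      by (intro span_add span_diff span_scale 1 2)
    moreover have "c *s (inv u (g i k) - c ^ k *s ?z (- int (Suc k))) - (q2 * s1 / r) *s ?z (int k)
        + (s2 / r) *s ?z (int k + 1) = g i (Suc k) - c ^ Suc k *s ?z (- int (Suc k))"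
      by (simp add: g_Suc scale_right_diff_distrib)
    ultimately show ?case by simp
  qed
  have f_lead: "f j - \<kappa> j *s e j \<in> span (e ` {k \<in> X \<times> UNIV. \<rho> k < \<rho> j})" if "j \<in> X \<times> UNIV" for j
  proof -
    obtain i n where j: "j = (i, n)" by (cases j)
    show ?thesis
    proof (cases "0 < n")
      case True
      then show ?thesis by (simp add: j f_def \<kappa>_def e_def span_zero)
    next
      case False
      define k where "k = nat (- n)"
      have n: "n = - int k" using False by (simp add: k_def)
      have "(\<lambda>m. zpow u m i) ` {- int k<..int k} \<subseteq> e ` {k \<in> X \<times> UNIV. \<rho> k < \<rho> j}"
      proof clarify
        fix m assume "m \<in> {- int k<..int k}"
        then show "zpow u m i \<in> e ` {k \<in> X \<times> UNIV. \<rho> k < \<rho> j}"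
          using that by (intro image_eqI[of _ _ "(i, m)"]) (auto simp: e_def \<rho>_def j n)
      qed
      from subsetD[OF span_mono[OF this] g_lead] show ?thesis
        by (simp add: j n f_def \<kappa>_def e_def)
    qed
  qed
  have \<kappa>0: "\<kappa> j \<noteq> 0" if "j \<in> X \<times> UNIV" for j
    using r0 q by (cases j) (simp add: \<kappa>_def c_def)
  have indE: "independent (e ` (X \<times> UNIV))" using S(1) X(2) by simp
  note F = triangular_family[OF X(1) indE \<kappa>0 f_lead]
  have spF: "span (f ` (X \<times> UNIV)) = UNIV" using F(3) X(2) S(2) by simp
  have ext: "\<exists>a. endo a \<and> (\<forall>i\<in>X. \<forall>n. a (f (i, n)) = h i n)" for h
  proof -
    obtain a where a: "endo a" "\<forall>v\<in>f ` (X \<times> UNIV). a v = (\<lambda>(i, n). h i n) (the_inv_into (X \<times> UNIV) f v)"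
      using self.linear_independent_extend[OF F(2), of "\<lambda>v. (\<lambda>(i, n). h i n) (the_inv_into (X \<times> UNIV) f v)"]
      by blast
    have "a (f (i, n)) = h i n" if "i \<in> X" for i n
      using a(2) that the_inv_into_f_f[OF F(1), of "(i, n)"] by simp
    then show ?thesis using a(1) by blast
  qed
  have eq_on: "a = b" if "endo a" "endo b" "\<And>i n. i \<in> X \<Longrightarrow> a (f (i, n)) = b (f (i, n))" for a b
  proof
    fix v show "a v = b v"
      by (rule self.linear_eq_on[OF that(1,2), of v "f ` (X \<times> UNIV)"]) (use spF that(3) in auto)
  qed
  \<comment> \<open>The reflection of \<open>n\<close> to \<open>1 - n\<close> has no fixed integer,
    so \<open>a\<close> consists of 2-by-2 blocks only. The reflection of \<open>n\<close> to
    \<open>- n\<close> fixes 0, which is why \<open>b\<close> needs the eigenvalue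
    \<open>r\<close>.\<close>
  obtain a where a: "endo a" "\<forall>i\<in>X. \<forall>n. a (f (i, n)) =
      (if n \<le> 0 then f (i, 1 - n) else s1 *s f (i, n) - q1 *s f (i, 1 - n))"
    using ext[of "\<lambda>i n. if n \<le> 0 then f (i, 1 - n) else s1 *s f (i, n) - q1 *s f (i, 1 - n)"] by blast
  obtain b where b: "endo b" "\<forall>i\<in>X. \<forall>n. b (f (i, n)) =
      (if n = 0 then r *s f (i, n) else if 0 < n then f (i, - n) else s2 *s f (i, n) - q2 *s f (i, - n))"
    using ext[of "\<lambda>i n. if n = 0 then r *s f (i, n) else if 0 < n then f (i, - n)
      else s2 *s f (i, n) - q2 *s f (i, - n)"] by blast
  have a_le: "a (f (i, n)) = f (i, 1 - n)" if "i \<in> X" "n \<le> 0" for i n using a(2) that by simp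
  have a_gt: "a (f (i, n)) = s1 *s f (i, n) - q1 *s f (i, 1 - n)" if "i \<in> X" "0 < n" for i n
    using a(2) that by simp
  have b_0: "b (f (i, 0)) = r *s f (i, 0)" if "i \<in> X" for i using b(2) that by simp
  have b_gt: "b (f (i, n)) = f (i, - n)" if "i \<in> X" "0 < n" for i n using b(2) that by simp
  have b_lt: "b (f (i, n)) = s2 *s f (i, n) - q2 *s f (i, - n)" if "i \<in> X" "n < 0" for i n
    using b(2) that by simp
  note lin_simps = self.linear_diff self.linear_scale self.linear_add
  have "a \<circ> a = (\<lambda>v. s1 *s a v - q1 *s v)"
  proof (rule eq_on[OF Vector_Spaces.linear_compose[OF a(1) a(1)] endo_combination[OF a(1)]])
    fix i and n :: int assume i: "i \<in> X"
    show "(a \<circ> a) (f (i, n)) = s1 *s a (f (i, n)) - q1 *s f (i, n)"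
    proof (cases "n \<le> 0")
      case True
      then show ?thesis using i a_gt[of i "1 - n"] by (simp add: a_le)
    next
      case False
      then show ?thesis using i a_le[of i "1 - n"] a_gt[of i n]
        by (simp add: lin_simps[OF a(1)])
    qed
  qed
  moreover have "b \<circ> b = (\<lambda>v. s2 *s b v - q2 *s v)"
  proof (rule eq_on[OF Vector_Spaces.linear_compose[OF b(1) b(1)] endo_combination[OF b(1)]])
    fix i and n :: int assume i: "i \<in> X"
    consider "n = 0" | "0 < n" | "n < 0" by linarith
    then show "(b \<circ> b) (f (i, n)) = s2 *s b (f (i, n)) - q2 *s f (i, n)"
    proof cases
      case 1
      then show ?thesis
        using i r by (simp add: b_0 lin_simps[OF b(1)] scale_left_diff_distrib[symmetric])
    next
      case 2
      then show ?thesis using i b_lt[of i "- n"] by (simp add: b_gt)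
    next
      case 3
      then show ?thesis using i b_gt[of i "- n"] b_lt[of i n] by (simp add: lin_simps[OF b(1)])
    qed
  qed
  moreover have "u = a \<circ> b"
  proof (rule eq_on[OF lin Vector_Spaces.linear_compose[OF b(1) a(1)]])
    fix i and n :: int assume i: "i \<in> X"
    have u_pos: "u (f (i, m)) = f (i, m + 1)" if "0 < m" for m
      using that zpow_Suc[OF bij, of m i] by (simp add: f_def self.linear_scale[OF lin])
    consider "n = 0" | "0 < n" | "n < 0" by linarith
    then show "u (f (i, n)) = (a \<circ> b) (f (i, n))"
    proof cases
      case 1
      have "u (f (i, 0)) = r *s f (i, 1)"
        using zpow_Suc[OF bij, of 0 i] r0 by (simp add: f_def g_0)
      then show ?thesis using i 1 a_le[of i 0] by (simp add: b_0 lin_simps[OF a(1)])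
    next
      case 2
      then show ?thesis using i u_pos[of n] a_le[of i "- n"] by (simp add: b_gt add.commute)
    next
      case 3
      \<comment> \<open>With \<open>n = - (k + 1)\<close>, applying \<open>u\<close> to the
        recursion step cancels \<open>inv u\<close>. This case dictated the recursion, including
        \<open>c = q1 * q2\<close>.\<close>
      define k where "k = nat (- n - 1)"
      have n: "n = - 1 - int k" using 3 by (simp add: k_def)
      have "f (i, n) = g i (Suc k)" by (simp add: f_def n nat_add_distrib)
      then have "u (f (i, n)) = c *s g i k - (q2 * s1 / r) *s zpow u (int k + 1) i
          + (s2 / r) *s zpow u (2 + int k) i"
        using zpow_Suc[OF bij, of "int k" i] zpow_Suc[OF bij, of "int k + 1" i]
        by (simp add: g_Suc lin_simps[OF lin] u_inv)
      also have "\<dots> = c *s f (i, - int k) - (q2 * s1) *s f (i, int k + 1) + s2 *s f (i, 2 + int k)"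
        by (simp add: f_def)
      also have "\<dots> = s2 *s f (i, 1 - n) - q2 *s (s1 *s f (i, - n) - q1 *s f (i, 1 + n))"
        by (simp add: n c_def scale_right_diff_distrib algebra_simps)
      also have "\<dots> = (a \<circ> b) (f (i, n))"
        using i 3 a_le[of i n] a_gt[of i "- n"] by (simp add: b_lt lin_simps[OF a(1)])
      finally show ?thesis .
    qed
  qed
  ultimately show ?thesis using a(1) b(1) by (auto simp: fun_eq_iff)
qed

end

section \<open>Normalized quadratics and the final factorization\<close>

lemma split_poly_has_root:
  assumes "split_poly p" "degree p = 2"
  shows "\<exists>r. poly p r = 0"
proof -
  obtain qs where qs: "\<forall>q\<in>set qs. degree q = 1" "p = prod_list qs"
    using assms(1) by (auto simp: split_poly_def)
  then obtain q qs' where q: "qs = q # qs'" using assms(2) by (cases qs) auto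
  then have "degree q = 1" using qs by simp
  then have "coeff q 1 \<noteq> 0" using leading_coeff_0_iff[of q] by auto
  then have "poly q (- coeff q 0 / coeff q 1) = 0"
    using \<open>degree q = 1\<close> by (simp add: poly_altdef)
  then have "poly p (- coeff q 0 / coeff q 1) = 0" by (simp add: qs(2) q)
  then show ?thesis by blast
qed

text \<open>Since \<open>p\<close> may fail to be monic, the relation for \<open>a\<close> is that
  of \<open>p\<close> divided by its leading coefficient.\<close>

lemma (in vector_space) endo_poly_quadratic:
  assumes p: "degree p = 2"
    and a: "\<And>v. a (a v) = (- coeff p 1 / coeff p 2) *s a v - (coeff p 0 / coeff p 2) *s v"
  shows "endo_poly scale p a = (\<lambda>v. 0)"
proof
  fix v
  have lc: "coeff p 2 \<noteq> 0" using p leading_coeff_0_iff[of p] by auto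
  have "endo_poly scale p a v = coeff p 0 *s v + coeff p 1 *s a v + coeff p 2 *s a (a v)"
    by (simp add: endo_poly_def p numeral_2_eq_2)
  also have "\<dots> = 0"
    using lc by (simp add: a scale_right_diff_distrib)
  finally show "endo_poly scale p a v = 0" .
qed

lemma quadratic_root_normalized:
  fixes p :: "'f::field poly"
  assumes "degree p = 2" "poly p r = 0"
  shows "r * r = (- coeff p 1 / coeff p 2) * r - coeff p 0 / coeff p 2"
proof -
  have lc: "coeff p 2 \<noteq> 0" using assms(1) leading_coeff_0_iff[of p] by auto
  have "coeff p 0 + coeff p 1 * r + coeff p 2 * (r * r) = 0"
    using assms by (simp add: poly_altdef numeral_2_eq_2)
  then show ?thesis using lc by (simp add: field_simps eq_neg_iff_add_eq_0)
qed

theorem theorem1p2: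
  fixes scale :: "'f::field \<Rightarrow> 'v::ab_group_add \<Rightarrow> 'v"
    and p1 p2 p3 p4 :: "'f poly"
    and x :: "'v \<Rightarrow> 'v"
  assumes "vector_space scale"
    and "infinite_dimensional scale"
    and "\<forall>p\<in>{p1, p2, p3, p4}. degree p = 2 \<and> split_poly p \<and> non_derogatory p"
    and "x \<in> automorphisms scale"
  shows "is_poly_product scale [p1, p2, p3, p4] x"
proof -
  interpret vector_space scale by fact
  obtain B where B: "independent B" "span B = UNIV"
    using maximal_independent_subset_extend[of "{}" UNIV] independent_empty by (metis empty_subsetI top.extremum_uniqueI)
  have "infinite B"
  proof
    assume "finite B"
    then have "finite_dimensional_vector_space scale B"
      using B by unfold_locales auto
    then show False using assms(2) by (auto simp: infinite_dimensional_def)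
  qed
  then interpret infinite_basis scale B using B by unfold_locales
  have x: "endo x" "bij x" using assms(4) by (auto simp: automorphisms_def endomorphisms_def)
  obtain u w where uw: "shift u" "shift w" "x = u \<circ> w" using automorphism_eq_shift_comp_shift[OF x] by blast
  \<comment> \<open>Applied to the pairs \<open>p1, p2\<close> and \<open>p3, p4\<close>. Nonzero
    values at 0 give nonzero constant terms, and the second polynomial of each pair supplies the
    root \<open>r\<close>.\<close>
  have factor: "\<exists>a b. endo a \<and> endo b \<and> endo_poly scale p a = (\<lambda>v. 0) \<and> endo_poly scale q b = (\<lambda>v. 0) \<and> y = a \<circ> b"
    if y: "shift y" and pq: "p \<in> {p1, p2, p3, p4}" "q \<in> {p1, p2, p3, p4}" for y p q
  proof -
    have p: "degree p = 2" "coeff p 0 \<noteq> 0" and q: "degree q = 2" "coeff q 0 \<noteq> 0" "split_poly q"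
      using assms(3) pq by (auto simp: non_derogatory_def poly_0_coeff_0)
    have lc: "coeff p 2 \<noteq> 0" "coeff q 2 \<noteq> 0"
      using p(1) q(1) leading_coeff_0_iff[of p] leading_coeff_0_iff[of q] by auto
    obtain r where "poly q r = 0" using split_poly_has_root q by blast
    note r = quadratic_root_normalized[OF q(1) this]
    have nz: "coeff p 0 / coeff p 2 \<noteq> 0" "coeff q 0 / coeff q 2 \<noteq> 0" using p q lc by simp_all
    obtain a b where "endo a" "endo b" "y = a \<circ> b"
      "\<forall>v. a (a v) = scale (- coeff p 1 / coeff p 2) (a v) - scale (coeff p 0 / coeff p 2) v"
      "\<forall>v. b (b v) = scale (- coeff q 1 / coeff q 2) (b v) - scale (coeff q 0 / coeff q 2) v"
      using shift_eq_comp_quadratic[OF y nz r] by blast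
    then show ?thesis using endo_poly_quadratic p(1) q(1) by blast
  qed
  obtain a1 a2 where a12: "endo a1" "endo a2" "endo_poly scale p1 a1 = (\<lambda>v. 0)" "endo_poly scale p2 a2 = (\<lambda>v. 0)"
    "u = a1 \<circ> a2" using factor[OF uw(1), of p1 p2] by auto
  obtain a3 a4 where a34: "endo a3" "endo a4" "endo_poly scale p3 a3 = (\<lambda>v. 0)" "endo_poly scale p4 a4 = (\<lambda>v. 0)"
    "w = a3 \<circ> a4" using factor[OF uw(2), of p3 p4] by auto
  show ?thesis
    unfolding is_poly_product_def
  proof (intro exI[of _ "[a1, a2, a3, a4]"] conjI)
    show "x = foldr (\<circ>) [a1, a2, a3, a4] id" by (simp add: uw(3) a12(5) a34(5) comp_assoc)
    show "\<forall>i<length [p1, p2, p3, p4]. [a1, a2, a3, a4] ! i \<in> endomorphisms scale \<and>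
        endo_poly scale ([p1, p2, p3, p4] ! i) ([a1, a2, a3, a4] ! i) = (\<lambda>v. 0)"
      using a12 a34 by (simp add: endomorphisms_def All_less_Suc numeral_eq_Suc)
  qed simp
qed

end
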